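(* Let $n \ge 1$ be an integer and let $E \subseteq (0,1)^n$ be uncountable. Then the following are equivalent: (1) $E$ is weakly Luzin. (2) The Filippov space $\Phi_E$ is hereditarily separable. (3) The Filippov space $\Phi_E$ is hereditarily Lindelöf. (4) The Filippov space $\Phi_E$ has no uncountable discrete subsets.
   Context: Let $1 \le n < \omega$. $S^{n-1} \subset \mathbb{R}^n$ is the unit sphere (so $S^0 = \{\pm 1\}$), $\|x\|$ is the Euclidean norm, and $\rho : \mathbb{R}^n \setminus \{0\} \to S^{n-1}$ is $\rho(x) = x/\|x\|$. Weakly Luzin sets: for $T \subseteq \mathbb{R}^n$ let $T^* = \{x - y : x,y \in T,\ x \neq y\}$. $T$ is skinny iff the closure $\mathrm{cl}(\rho(T^* ))$ (of the image $\rho(T^* )$ in $S^{n-1}$) is not equal to $S^{n-1}$. A set $E \subseteq \mathbb{R}^n$ is weakly Luzin iff $E$ is uncountable and every skinny subset of $E$ is countable. Filippov space: for $E \subseteq (0,1)^n$ let $E' = [0,1]^n \setminus E$. As a set, $\Phi_E = (E \times S^{n-1}) \cup E'$. Define $\pi : \Phi_E \to [0,1]^n$ by $\pi(x,w) = x$ for $(x,w) \in E \times S^{n-1}$ and $\pi(x) = x$ for $x \in E'$. For $\varepsilon > 0$ and $x \in E'$ let $$B(x,\varepsilon) = \{p \in \Phi_E : \|\pi(p) - x\| < \varepsilon\},$$ and for $\varepsilon>0$, $x \in E$ and $W$ an open subset of $S^{n-1}$ let $$B(x,W,\varepsilon) = (\{x\} \times W) \cup \{p \in \Phi_E : 0 <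 \|\pi(p) - x\| < \varepsilon \text{ and } \rho(\pi(p) - x) \in W\}.$$ $\Phi_E$ has the topology for which all the sets $B(x,\varepsilon)$ and $B(x,W,\varepsilon)$ form a base. A space is hereditarily separable (hereditarily Lindelöf) if every subspace is separable (Lindelöf). A subset is discrete if its subspace topology is discrete. *)

theory Defs
  imports "HOL-Analysis.Analysis"
begin

definition rho :: "real ^ 'n \<Rightarrow> real ^ 'n" where
  "rho x = x /\<^sub>R norm x"

definition diff_star :: "(real ^ 'n) set \<Rightarrow> (real ^ 'n) set" where
  "diff_star T = {x - y | x y. x \<in> T \<and> y \<in> T \<and> x \<noteq> y}"

(* The sphere is closed, so the closure in the ambient space is the closure in the sphere. *)
definition skinny :: "(real ^ 'n) set \<Rightarrow> bool" where
  "skinny T \<longleftrightarrow> closure (rho ` diff_star T) \<noteq> sphere 0 1"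

definition weakly_Luzin :: "(real ^ 'n) set \<Rightarrow> bool" where
  "weakly_Luzin E \<longleftrightarrow> uncountable E \<and> (\<forall>T. T \<subseteq> E \<and> skinny T \<longrightarrow> countable T)"

(* Points of the Filippov space: Inl (x, w) stands for (x, w) with x in E and w in the unit
   sphere, Inr x for a point x of the cube outside E. Here 0 and 1 are the constant vectors,
   so that cbox 0 1 is the closed and box 0 1 the open unit cube. *)
type_synonym 'n filippov_point = "(real ^ 'n) \<times> (real ^ 'n) + real ^ 'n"

definition filippov_carrier :: "(real ^ 'n) set \<Rightarrow> 'n filippov_point set" where
  "filippov_carrier E = Inl ` (E \<times> sphere 0 1) \<union> Inr ` (cbox 0 1 - E)"

fun filippov_proj :: "'n filippov_point \<Rightarrow> real ^ 'n" where
  "filippov_proj (Inl (x, w)) = x"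
| "filippov_proj (Inr x) = x"

definition filippov_ball :: "(real ^ 'n) set \<Rightarrow> real ^ 'n \<Rightarrow> real \<Rightarrow> 'n filippov_point set" where
  "filippov_ball E x \<epsilon> = {p \<in> filippov_carrier E. norm (filippov_proj p - x) < \<epsilon>}"

definition filippov_cone ::
  "(real ^ 'n) set \<Rightarrow> real ^ 'n \<Rightarrow> (real ^ 'n) set \<Rightarrow> real \<Rightarrow> 'n filippov_point set" where
  "filippov_cone E x W \<epsilon> = Inl ` ({x} \<times> W) \<union>
     {p \<in> filippov_carrier E. 0 < norm (filippov_proj p - x) \<and> norm (filippov_proj p - x) < \<epsilon> \<and>
        rho (filippov_proj p - x) \<in> W}"

definition filippov_base :: "(real ^ 'n) set \<Rightarrow> 'n filippov_point set set" where
  "filippov_base E =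
     {filippov_ball E x \<epsilon> | x \<epsilon>. x \<in> cbox 0 1 - E \<and> 0 < \<epsilon>} \<union>
     {filippov_cone E x W \<epsilon> | x W \<epsilon>. x \<in> E \<and> openin (top_of_set (sphere 0 1)) W \<and> 0 < \<epsilon>}"

(* filippov_base is a base of this topology, not merely a subbase: see openin_filippov_space. *)
definition filippov_space :: "(real ^ 'n) set \<Rightarrow> 'n filippov_point topology" where
  "filippov_space E = topology_generated_by (filippov_base E)"

definition hereditarily_separable :: "'a topology \<Rightarrow> bool" where
  "hereditarily_separable X \<longleftrightarrow> (\<forall>S. S \<subseteq> topspace X \<longrightarrow> separable_space (subtopology X S))"

definition hereditarily_Lindelof :: "'a topology \<Rightarrow> bool" where
  "hereditarily_Lindelof X \<longleftrightarrow> (\<forall>S. S \<subseteq> topspace X \<longrightarrow> Lindelof_space (subtopology X S))"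

definition discrete_subset :: "'a topology \<Rightarrow> 'a set \<Rightarrow> bool" where
  "discrete_subset X D \<longleftrightarrow> D \<subseteq> topspace X \<and> subtopology X D = discrete_topology D"

lemma filippov_cone_subset:
  assumes "x \<in> E" "openin (top_of_set (sphere 0 1)) W"
  shows "filippov_cone E x W \<epsilon> \<subseteq> filippov_carrier E"
  using assms openin_imp_subset[OF assms(2)]
  by (auto simp: filippov_cone_def filippov_carrier_def)

lemma rho_sphere: "x \<noteq> 0 \<Longrightarrow> rho x \<in> sphere 0 1"
  by (simp add: rho_def)

lemma continuous_on_rho: "continuous_on (- {0}) rho"
  unfolding rho_def by (intro continuous_intros) auto

lemma topspace_filippov_space:
  assumes "E \<subseteq> box 0 1"
  shows "topspace (filippov_space E) = filippov_carrier E"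
proof
  show "topspace (filippov_space E) \<subseteq> filippov_carrier E"
    unfolding filippov_space_def topology_generated_by_topspace filippov_base_def
    using filippov_cone_subset[of _ E] by (auto simp: filippov_ball_def)
  show "filippov_carrier E \<subseteq> topspace (filippov_space E)"
  proof
    fix p assume p: "p \<in> filippov_carrier E"
    show "p \<in> topspace (filippov_space E)"
    proof (cases p)
      case (Inl q)
      then obtain x w where "p = Inl (x, w)" "x \<in> E" "w \<in> sphere 0 1"
        using p by (auto simp: filippov_carrier_def)
      then have "p \<in> filippov_cone E x (sphere 0 1) 1" "filippov_cone E x (sphere 0 1) 1 \<in> filippov_base E"
        by (auto simp: filippov_cone_def filippov_base_def
              intro!: exI[of _ x] exI[of _ "sphere 0 1"] exI[of _ "1::real"])
      then show ?thesis by (auto simp: filippov_space_def)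
    next
      case (Inr x)
      then have "x \<in> cbox 0 1 - E" using p by (auto simp: filippov_carrier_def)
      then have "filippov_ball E x 1 \<in> filippov_base E"
        unfolding filippov_base_def using zero_less_one by blast
      moreover have "p \<in> filippov_ball E x 1" using Inr p by (simp add: filippov_ball_def)
      ultimately show ?thesis by (auto simp: filippov_space_def)
    qed
  qed
qed

lemma ball_in_cone:
  assumes W: "openin (top_of_set (sphere 0 1)) W"
    and y: "0 < norm (y - x)" "norm (y - x) < \<epsilon>" "rho (y - x) \<in> W"
  obtains \<delta> where "\<delta> > 0" "filippov_ball E y \<delta> \<subseteq> filippov_cone E x W \<epsilon>"
proof -
  obtain O' where O': "open O'" "W = sphere 0 1 \<inter> O'"
    using W by (auto simp: openin_open)
  have "open (- {0} \<inter> rho -` O')"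
    using continuous_open_preimage[OF continuous_on_rho _ O'(1)] by auto
  moreover have "y - x \<in> - {0} \<inter> rho -` O'" using y O' by auto
  ultimately obtain d where d: "d > 0" "\<And>z. dist z (y - x) < d \<Longrightarrow> z \<in> - {0} \<inter> rho -` O'"
    unfolding open_dist by blast
  define \<delta> where "\<delta> = min d (\<epsilon> - norm (y - x))"
  have "\<delta> > 0" using d y by (simp add: \<delta>_def)
  moreover have "filippov_ball E y \<delta> \<subseteq> filippov_cone E x W \<epsilon>"
  proof
    fix p assume p: "p \<in> filippov_ball E y \<delta>"
    let ?z = "filippov_proj p"
    have n: "norm (?z - y) < \<delta>" using p by (simp add: filippov_ball_def)
    then have "dist (?z - x) (y - x) < d" by (simp add: \<delta>_def dist_norm)
    then have z: "?z - x \<noteq> 0" "rho (?z - x) \<in> O'" using d(2) by blast+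
    have "norm (?z - x) \<le> norm (?z - y) + norm (y - x)"
      using norm_triangle_ineq[of "?z - y" "y - x"] by simp
    then have "norm (?z - x) < \<epsilon>" using n by (simp add: \<delta>_def)
    then show "p \<in> filippov_cone E x W \<epsilon>"
      using z rho_sphere[OF z(1)] O'(2) p by (auto simp: filippov_cone_def filippov_ball_def)
  qed
  ultimately show ?thesis using that by blast
qed

lemma ball_in_ball:
  assumes "norm (y - x) < \<epsilon>"
  shows "filippov_ball E y (\<epsilon> - norm (y - x)) \<subseteq> filippov_ball E x \<epsilon>"
proof
  fix p assume p: "p \<in> filippov_ball E y (\<epsilon> - norm (y - x))"
  have "norm (filippov_proj p - x) \<le> norm (filippov_proj p - y) + norm (y - x)"
    using norm_triangle_ineq[of "filippov_proj p - y" "y - x"] by simp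
  then show "p \<in> filippov_ball E x \<epsilon>" using p by (simp add: filippov_ball_def)
qed

lemma cone_in_ball:
  assumes "y \<in> E" "openin (top_of_set (sphere 0 1)) W" "\<delta> > 0"
  shows "filippov_cone E y W \<delta> \<subseteq> filippov_ball E y \<delta>"
  using assms filippov_cone_subset[OF assms(1,2)]
  by (auto simp: filippov_ball_def filippov_cone_def)

lemma filippov_base_contains_ball:
  assumes B: "B \<in> filippov_base E" "Inr y \<in> B"
  obtains \<delta> where "\<delta> > 0" "filippov_ball E y \<delta> \<subseteq> B"
proof -
  from B(1) consider
    x \<epsilon> where "B = filippov_ball E x \<epsilon>" |
    x W \<epsilon> where "B = filippov_cone E x W \<epsilon>" "openin (top_of_set (sphere 0 1)) W"
    by (auto simp: filippov_base_def)
  then show ?thesis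
  proof cases
    case (1 x \<epsilon>)
    then have "norm (y - x) < \<epsilon>" using B(2) by (auto simp: filippov_ball_def)
    then show ?thesis using that[of "\<epsilon> - norm (y - x)"] ball_in_ball[of y x \<epsilon> E] 1 by auto
  next
    case (2 x W \<epsilon>)
    then have "0 < norm (y - x)" "norm (y - x) < \<epsilon>" "rho (y - x) \<in> W"
      using B(2) by (auto simp: filippov_cone_def)
    then show ?thesis using ball_in_cone[OF 2(2)] 2(1) that by metis
  qed
qed

lemma filippov_base_contains_cone:
  assumes B: "B \<in> filippov_base E" "Inl (y, w) \<in> B" and y: "y \<in> E" "w \<in> sphere 0 1"
  obtains W \<delta> where "\<delta> > 0" "openin (top_of_set (sphere 0 1)) W" "w \<in> W" "filippov_cone E y W \<delta> \<subseteq> B"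
proof -
  have S: "openin (top_of_set (sphere 0 1)) (sphere 0 (1::real) :: (real^'a) set)" by simp
  from B(1) consider
    x \<epsilon> where "B = filippov_ball E x \<epsilon>" |
    x W \<epsilon> where "B = filippov_cone E x W \<epsilon>" "openin (top_of_set (sphere 0 1)) W" "\<epsilon> > 0"
    by (auto simp: filippov_base_def)
  then show ?thesis
  proof cases
    case (1 x \<epsilon>)
    then have n: "norm (y - x) < \<epsilon>" using B(2) by (auto simp: filippov_ball_def)
    have "filippov_cone E y (sphere 0 1) (\<epsilon> - norm (y - x)) \<subseteq> B"
      using cone_in_ball[OF y(1) S, of "\<epsilon> - norm (y - x)"] ball_in_ball[OF n, of E] n 1 by auto
    then show ?thesis using that[OF _ S y(2), of "\<epsilon> - norm (y - x)"] n by simp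
  next
    case (2 x W \<epsilon>)
    show ?thesis
    proof (cases "x = y")
      case True
      then have "w \<in> W" using B(2) 2 by (auto simp: filippov_cone_def)
      then show ?thesis using that 2 True by blast
    next
      case False
      then have "0 < norm (y - x)" "norm (y - x) < \<epsilon>" "rho (y - x) \<in> W"
        using B(2) 2 by (auto simp: filippov_cone_def)
      then obtain \<delta> where "\<delta> > 0" "filippov_ball E y \<delta> \<subseteq> B" using ball_in_cone[OF 2(2)] 2(1) by metis
      then show ?thesis using that[OF _ S y(2)] cone_in_ball[OF y(1) S] by blast
    qed
  qed
qed

lemma filippov_cone_mono:
  "W \<subseteq> W' \<Longrightarrow> \<delta> \<le> \<delta>' \<Longrightarrow> filippov_cone E y W \<delta> \<subseteq> filippov_cone E y W' \<delta>'"
  by (fastforce simp: filippov_cone_def)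

lemma filippov_base_Int:
  assumes B: "B1 \<in> filippov_base E" "B2 \<in> filippov_base E" and p: "p \<in> B1" "p \<in> B2"
    and E: "E \<subseteq> box 0 1"
  shows "\<exists>B \<in> filippov_base E. p \<in> B \<and> B \<subseteq> B1 \<inter> B2"
proof -
  have pc: "p \<in> filippov_carrier E"
    using B(1) p(1) topspace_filippov_space[OF E] by (auto simp: filippov_space_def)
  show ?thesis
  proof (cases p)
    case (Inl q)
    then obtain y w where yw: "p = Inl (y, w)" "y \<in> E" "w \<in> sphere 0 1"
      using pc by (auto simp: filippov_carrier_def)
    obtain W1 d1 where 1: "d1 > 0" "openin (top_of_set (sphere 0 1)) W1" "w \<in> W1" "filippov_cone E y W1 d1 \<subseteq> B1"
      using filippov_base_contains_cone[OF B(1)] p(1) yw by metis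
    obtain W2 d2 where 2: "d2 > 0" "openin (top_of_set (sphere 0 1)) W2" "w \<in> W2" "filippov_cone E y W2 d2 \<subseteq> B2"
      using filippov_base_contains_cone[OF B(2)] p(2) yw by metis
    let ?C = "filippov_cone E y (W1 \<inter> W2) (min d1 d2)"
    have "openin (top_of_set (sphere 0 1)) (W1 \<inter> W2)" "min d1 d2 > 0" using 1 2 by auto
    then have "?C \<in> filippov_base E" using yw(2) unfolding filippov_base_def by blast
    moreover have "p \<in> ?C" using yw(1) 1 2 by (auto simp: filippov_cone_def)
    moreover have "?C \<subseteq> B1" using filippov_cone_mono[of "W1 \<inter> W2" W1 "min d1 d2" d1 E y] 1 by auto
    moreover have "?C \<subseteq> B2" using filippov_cone_mono[of "W1 \<inter> W2" W2 "min d1 d2" d2 E y] 2 by auto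
    ultimately show ?thesis by blast
  next
    case (Inr y)
    then have y: "y \<in> cbox 0 1 - E" using pc by (auto simp: filippov_carrier_def)
    obtain d1 where 1: "d1 > 0" "filippov_ball E y d1 \<subseteq> B1"
      using filippov_base_contains_ball[OF B(1)] p(1) Inr by metis
    obtain d2 where 2: "d2 > 0" "filippov_ball E y d2 \<subseteq> B2"
      using filippov_base_contains_ball[OF B(2)] p(2) Inr by metis
    let ?C = "filippov_ball E y (min d1 d2)"
    have "min d1 d2 > 0" using 1 2 by auto
    then have "?C \<in> filippov_base E" using y unfolding filippov_base_def by blast
    moreover have "p \<in> ?C" using pc Inr 1 2 by (auto simp: filippov_ball_def)
    moreover have "?C \<subseteq> B1 \<inter> B2" using 1 2 by (auto simp: filippov_ball_def)
    ultimately show ?thesis by blast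
  qed
qed

theorem openin_filippov_space:
  assumes E: "E \<subseteq> box 0 1"
  shows "openin (filippov_space E) U \<longleftrightarrow> (\<forall>p\<in>U. \<exists>B\<in>filippov_base E. p \<in> B \<and> B \<subseteq> U)"
proof
  assume "openin (filippov_space E) U"
  then have "generate_topology_on (filippov_base E) U"
    unfolding filippov_space_def by (rule openin_topology_generated_by)
  then show "\<forall>p\<in>U. \<exists>B\<in>filippov_base E. p \<in> B \<and> B \<subseteq> U"
  proof induction
    case (Int a b)
    show ?case
    proof
      fix p assume "p \<in> a \<inter> b"
      then obtain B1 B2 where "B1 \<in> filippov_base E" "B2 \<in> filippov_base E" "p \<in> B1" "p \<in> B2"
        "B1 \<subseteq> a" "B2 \<subseteq> b" using Int by blast
      then show "\<exists>B\<in>filippov_base E. p \<in> B \<and> B \<subseteq> a \<inter> b"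
        using filippov_base_Int[OF _ _ _ _ E, of B1 B2 p] by blast
    qed
  next
    case (UN K)
    show ?case
    proof
      fix p assume "p \<in> \<Union> K"
      then obtain k where k: "k \<in> K" "p \<in> k" by blast
      then obtain B where "B \<in> filippov_base E" "p \<in> B" "B \<subseteq> k" using UN by meson
      then show "\<exists>B\<in>filippov_base E. p \<in> B \<and> B \<subseteq> \<Union> K" using k(1) by blast
    qed
  qed auto
next
  assume *: "\<forall>p\<in>U. \<exists>B\<in>filippov_base E. p \<in> B \<and> B \<subseteq> U"
  have "openin (filippov_space E) B" if "B \<in> filippov_base E" for B
    unfolding filippov_space_def using that by (rule topology_generated_by_Basis)
  then have "\<forall>p\<in>U. \<exists>B. openin (filippov_space E) B \<and> p \<in> B \<and> B \<subseteq> U"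
    using * by meson
  then show "openin (filippov_space E) U"
    using openin_subopen[of "filippov_space E" U] by simp
qed

end

theory Submission
  imports Defs
begin

text \<open>If \<open>T \<subseteq> E\<close> has no two nearby points whose direction lies in a fixed open part
  \<open>W\<close> of the sphere, then \<open>T\<close> is a countable union of skinny sets. A point of a fibre of the Filippov
  space that is left uncovered by (or not approximated by) countably many cones of direction \<open>W\<close>
  lies over such a set \<open>T\<close>, which the weak Luzin property makes countable. Conversely, over an
  uncountable skinny set a constant section with value outside the closure of the directions is
  discrete.\<close>

section \<open>Direction cones in Euclidean space and neighbourhoods in the Filippov space\<close>

definition direction_cone :: "real ^ 'n \<Rightarrow> (real ^ 'n) set \<Rightarrow> real \<Rightarrow> (real ^ 'n) set" where
  "direction_cone x N e = {z. 0 < norm (z - x) \<and> norm (z - x) < e \<and> rho (z - x) \<in> N}"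

lemma open_direction_cone:
  assumes "open N"
  shows "open (direction_cone x N e)"
proof -
  have "open (- {0} \<inter> rho -` N)"
    using continuous_open_preimage[OF continuous_on_rho _ assms] by auto
  then have "open ((\<lambda>z. z - x) -` (- {0} \<inter> rho -` N))"
    by (intro open_vimage continuous_intros)
  then have "open (((\<lambda>z. z - x) -` (- {0} \<inter> rho -` N)) \<inter> ball x e)"
    by blast
  moreover have "direction_cone x N e = ((\<lambda>z. z - x) -` (- {0} \<inter> rho -` N)) \<inter> ball x e"
    by (auto simp: direction_cone_def dist_norm norm_minus_commute)
  ultimately show ?thesis by simp
qed

text \<open>Since \<open>rho\<close> maps nonzero vectors into the sphere, cutting \<open>N\<close>
  down to the sphere matters only on the fibre over \<open>x\<close>. Off that fibre the cone is the
  preimage of a Euclidean open set under \<open>filippov_proj\<close>, so Euclidean Lindelof and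
  density arguments apply there.\<close>

lemma filippov_cone_eq:
  "filippov_cone E x (sphere 0 1 \<inter> N) e =
     Inl ` ({x} \<times> (sphere 0 1 \<inter> N)) \<union> {p \<in> filippov_carrier E. filippov_proj p \<in> direction_cone x N e}"
proof -
  have "rho z \<in> sphere 0 1 \<inter> N \<longleftrightarrow> rho z \<in> N" if "0 < norm z" for z :: "real ^ 'a"
    using that rho_sphere[of z] by auto
  then show ?thesis unfolding filippov_cone_def direction_cone_def by blast
qed

lemma openin_filippov_Inr:
  assumes "E \<subseteq> box 0 1" "openin (filippov_space E) U" "Inr x \<in> U"
  obtains e where "e > 0" "filippov_ball E x e \<subseteq> U"
proof -
  obtain B where "B \<in> filippov_base E" "Inr x \<in> B" "B \<subseteq> U"
    using assms openin_filippov_space by blast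
  then show ?thesis using filippov_base_contains_ball that by (metis subset_trans)
qed

text \<open>Neighbourhoods are normalised to shapes indexed by a basic open set \<open>N\<close> of
  the ambient space and a number \<open>m\<close>. With a countable basis only countably many shapes
  occur, so the later arguments may treat each pair \<open>(N, m)\<close> separately.\<close>

lemma openin_filippov_Inl:
  assumes "E \<subseteq> box 0 1" "openin (filippov_space E) U" "Inl (x, w) \<in> U"
    and \<B>: "topological_basis \<B>"
  obtains N m where "N \<in> \<B>" "w \<in> N" "filippov_cone E x (sphere 0 1 \<inter> N) (1 / Suc m) \<subseteq> U"
proof -
  have xw: "x \<in> E" "w \<in> sphere 0 1"
    using openin_subset[OF assms(2)] assms(3) topspace_filippov_space[OF assms(1)]
    by (auto simp: filippov_carrier_def)
  obtain B where B: "B \<in> filippov_base E" "Inl (x, w) \<in> B" "B \<subseteq> U"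
    using assms openin_filippov_space by blast
  obtain W d where d: "d > 0" "openin (top_of_set (sphere 0 1)) W" "w \<in> W"
      "filippov_cone E x W d \<subseteq> B"
    using filippov_base_contains_cone[OF B(1,2) xw] .
  obtain G where G: "open G" "W = sphere 0 1 \<inter> G"
    using d(2) by (auto simp: openin_open)
  obtain N where N: "N \<in> \<B>" "w \<in> N" "N \<subseteq> G"
    using topological_basisE[OF \<B> G(1), of w] d(3) G(2) by blast
  obtain m where "1 / real (Suc m) < d"
    using d(1) nat_approx_posE by blast
  then have "filippov_cone E x (sphere 0 1 \<inter> N) (1 / Suc m) \<subseteq> filippov_cone E x W d"
    using N(3) G(2) by (intro filippov_cone_mono) auto
  then show ?thesis using that[OF N(1,2)] d(4) B(3) by blast
qed

text \<open>Two points of a ball of radius \<open>e / 2\<close> are less than \<open>e\<close>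
  apart, so by \<open>avoid\<close> the directions between distinct points of \<open>T\<close> in it
  lie in the closed set \<open>- N\<close>. Their closure misses the unit vector \<open>w\<close>,
  which makes this piece of \<open>T\<close> skinny. Countably many such balls, centred in a dense
  set, cover \<open>T\<close>.\<close>

lemma weakly_Luzin_countable:
  assumes E: "weakly_Luzin E" and T: "T \<subseteq> E"
    and N: "open N" "w \<in> N" "w \<in> sphere 0 1" and "e > 0"
    and avoid: "\<And>x y. x \<in> T \<Longrightarrow> y \<in> T \<Longrightarrow> y \<notin> direction_cone x N e"
  shows "countable T"
proof -
  obtain D :: "(real ^ 'a) set" where D: "countable D" "\<And>X. open X \<Longrightarrow> X \<noteq> {} \<Longrightarrow> \<exists>d\<in>D. d \<in> X"
    by (rule countable_dense_setE) blast
  have piece: "countable (T \<inter> ball q (e / 2))" for q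
  proof -
    have "rho ` diff_star (T \<inter> ball q (e / 2)) \<subseteq> - N"
    proof clarsimp
      fix v assume "v \<in> diff_star (T \<inter> ball q (e / 2))" "rho v \<in> N"
      then obtain x y where v: "v = y - x" "x \<in> T" "y \<in> T" "x \<noteq> y"
          "dist q x < e / 2" "dist q y < e / 2" "rho (y - x) \<in> N"
        by (auto simp: diff_star_def)
      then have "dist y x < e" using dist_triangle_half_r by blast
      then show False using avoid[OF v(2,3)] v by (simp add: direction_cone_def dist_norm)
    qed
    then have "closure (rho ` diff_star (T \<inter> ball q (e / 2))) \<subseteq> - N"
      using N(1) by (intro closure_minimal) auto
    then have "skinny (T \<inter> ball q (e / 2))"
      using N unfolding skinny_def by blast
    then show ?thesis using E T unfolding weakly_Luzin_def by blast
  qed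
  have "T \<subseteq> (\<Union>q\<in>D. T \<inter> ball q (e / 2))"
  proof
    fix x assume "x \<in> T"
    moreover obtain q where "q \<in> D" "q \<in> ball x (e / 2)"
      using D(2)[of "ball x (e / 2)"] \<open>e > 0\<close> by auto
    ultimately show "x \<in> (\<Union>q\<in>D. T \<inter> ball q (e / 2))" by (auto simp: dist_commute)
  qed
  then show ?thesis using D(1) piece by (meson countable_UN countable_subset)
qed

text \<open>The subfamily is selected by indices rather than by sets: in the applications the index,
  a centre or a centre with a radius, determines which member of the given cover is chosen.\<close>

lemma Lindelof_indexed:
  fixes C :: "'i \<Rightarrow> 'a::second_countable_topology set"
  assumes "\<And>i. i \<in> I \<Longrightarrow> open (C i)"
  obtains J where "J \<subseteq> I" "countable J" "\<Union> (C ` J) = \<Union> (C ` I)"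
proof -
  obtain \<F> where "\<F> \<subseteq> C ` I" "countable \<F>" "\<Union> \<F> = \<Union> (C ` I)"
    by (rule Lindelof[of "C ` I"]) (use assms in auto)
  then obtain J where "countable J" "J \<subseteq> I" "\<F> = C ` J"
    using countable_subset_image[of \<F> C I] by blast
  then show ?thesis using that \<open>\<Union> \<F> = \<Union> (C ` I)\<close> by simp
qed

section \<open>From weakly Luzin to hereditarily Lindelof\<close>

lemma weakly_Luzin_imp_hereditarily_Lindelof:
  assumes sub: "E \<subseteq> box 0 1" and E: "weakly_Luzin E"
  shows "hereditarily_Lindelof (filippov_space E)"
  unfolding hereditarily_Lindelof_def
proof (intro allI impI)
  fix S assume S: "S \<subseteq> topspace (filippov_space E)"
  then have carrier: "S \<subseteq> filippov_carrier E" using topspace_filippov_space[OF sub] by simp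
  show "Lindelof_space (subtopology (filippov_space E) S)"
    unfolding Lindelof_space_subtopology_subset[OF S]
  proof clarify
    fix \<U> assume op: "\<forall>U\<in>\<U>. openin (filippov_space E) U" and cover: "S \<subseteq> \<Union> \<U>"
    obtain \<B> :: "(real ^ 'a) set set" where \<B>: "countable \<B>" "topological_basis \<B>"
      using ex_countable_basis by blast
    \<comment> \<open>A Filippov ball is the full preimage in the carrier of a Euclidean ball. Hence
      countably many Euclidean balls with the same union as all those from \<open>F\<close> give
      countably many members of the cover that catch every \<open>Inr\<close> point of
      \<open>S\<close>.\<close>
    define F where "F = {(x, e). \<exists>U\<in>\<U>. filippov_ball E x e \<subseteq> U}"
    obtain F' where F': "F' \<subseteq> F" "countable F'"
        "(\<Union>(x, e)\<in>F'. ball x e) = (\<Union>(x, e)\<in>F. ball x e)"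
      by (rule Lindelof_indexed[of F "\<lambda>(x, e). ball x e"]) auto
    obtain u where u: "\<And>x e. (x, e) \<in> F \<Longrightarrow> u (x, e) \<in> \<U> \<and> filippov_ball E x e \<subseteq> u (x, e)"
    proof -
      have "\<forall>p\<in>F. \<exists>U\<in>\<U>. filippov_ball E (fst p) (snd p) \<subseteq> U" by (auto simp: F_def)
      then show ?thesis using that bchoice[of F "\<lambda>p U. U \<in> \<U> \<and> filippov_ball E (fst p) (snd p) \<subseteq> U"]
        by fastforce
    qed
    have Inr_cover: "p \<in> \<Union> (u ` F')" if p: "p \<in> S" "p = Inr x" for p x
    proof -
      obtain U where U: "U \<in> \<U>" "p \<in> U" using cover p by blast
      obtain e where "e > 0" "filippov_ball E x e \<subseteq> U"
        using openin_filippov_Inr[OF sub] op U p(2) by metis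
      then have "(x, e) \<in> F" "x \<in> ball x e" using U(1) by (auto simp: F_def)
      then have "x \<in> (\<Union>(x, e)\<in>F. ball x e)" by blast
      then obtain y d where y: "(y, d) \<in> F'" "x \<in> ball y d" unfolding F'(3)[symmetric] by blast
      then have "p \<in> filippov_ball E y d"
        using p carrier by (auto simp: filippov_ball_def dist_norm norm_minus_commute)
      then show ?thesis using u y(1) F'(1) by blast
    qed
    \<comment> \<open>The points of \<open>S\<close> in fibres that have a neighbourhood of shape
      \<open>(N, m)\<close> inside a single member of the cover. These countably many sets exhaust
      the fibre part of \<open>S\<close>, so it suffices to cover each one countably.\<close>
    define P where "P N m = {p \<in> S. \<exists>x w. p = Inl (x, w) \<and> w \<in> N \<and>
        (\<exists>U\<in>\<U>. filippov_cone E x (sphere 0 1 \<inter> N) (1 / Suc m) \<subseteq> U)}" for N and m :: nat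
    have "\<exists>\<V>. countable \<V> \<and> \<V> \<subseteq> \<U> \<and> P N m \<subseteq> \<Union> \<V>" if N: "N \<in> \<B>" for N m
    proof (cases "P N m = {}")
      case True then show ?thesis by (intro exI[of _ "{}"]) auto
    next
      case False
      then obtain w where w: "w \<in> N" "w \<in> sphere 0 1"
        using carrier by (force simp: P_def filippov_carrier_def)
      have "open N" using N \<B>(2) by (simp add: topological_basis_open)
      define C where "C = (\<lambda>x. direction_cone x N (1 / Suc m))"
      define A where "A = {x \<in> E. \<exists>U\<in>\<U>. filippov_cone E x (sphere 0 1 \<inter> N) (1 / Suc m) \<subseteq> U}"
      obtain A' where A': "A' \<subseteq> A" "countable A'" "\<Union> (C ` A') = \<Union> (C ` A)"
        using Lindelof_indexed[of A C] open_direction_cone[OF \<open>open N\<close>] unfolding C_def by blast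
      \<comment> \<open>The exceptional centres, lying in no cone with centre in \<open>A\<close>.
        No point of \<open>T\<close> is in a cone at a point of \<open>T\<close>, so
        \<open>T\<close> is countable. A point of \<open>P N m\<close> over \<open>A - T\<close> is
        caught by a cone with centre in \<open>A'\<close>, and one over \<open>T\<close> by the
        fibre part of the cone at its own base point.\<close>
      define T where "T = A - \<Union> (C ` A)"
      have "countable T"
        by (rule weakly_Luzin_countable[OF E _ \<open>open N\<close> w, of _ "1 / Suc m"])
          (auto simp: T_def C_def A_def)
      have "\<forall>x\<in>A. \<exists>U\<in>\<U>. filippov_cone E x (sphere 0 1 \<inter> N) (1 / Suc m) \<subseteq> U"
        by (auto simp: A_def)
      then obtain v where v: "\<And>x. x \<in> A \<Longrightarrow> v x \<in> \<U>"
          "\<And>x. x \<in> A \<Longrightarrow> filippov_cone E x (sphere 0 1 \<inter> N) (1 / Suc m) \<subseteq> v x"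
        by metis
      have "P N m \<subseteq> \<Union> (v ` (A' \<union> T))"
      proof
        fix p assume p: "p \<in> P N m"
        then obtain x z where xz: "p = Inl (x, z)" "z \<in> N" "p \<in> filippov_carrier E" "x \<in> A"
            "z \<in> sphere 0 1"
          using carrier by (force simp: P_def A_def filippov_carrier_def)
        show "p \<in> \<Union> (v ` (A' \<union> T))"
        proof (cases "x \<in> T")
          case True
          have "p \<in> filippov_cone E x (sphere 0 1 \<inter> N) (1 / Suc m)"
            using xz by (simp add: filippov_cone_eq)
          then show ?thesis using v(2)[OF xz(4)] True by blast
        next
          case False
          then have "x \<in> \<Union> (C ` A')" using xz(4) A'(3) by (simp add: T_def)
          then obtain y where y: "y \<in> A'" "x \<in> C y" by blast
          then have "p \<in> filippov_cone E y (sphere 0 1 \<inter> N) (1 / Suc m)"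
            using xz by (simp add: filippov_cone_eq C_def)
          then show ?thesis using v(2)[of y] y(1) A'(1) by blast
        qed
      qed
      moreover have "countable (v ` (A' \<union> T))" using A'(2) \<open>countable T\<close> by simp
      moreover have "v ` (A' \<union> T) \<subseteq> \<U>" using v(1) A'(1) by (auto simp: T_def)
      ultimately show ?thesis by blast
    qed
    then obtain V where V: "\<And>N m. N \<in> \<B> \<Longrightarrow> countable (V N m) \<and> V N m \<subseteq> \<U> \<and> P N m \<subseteq> \<Union> (V N m)"
      by metis
    define \<V> where "\<V> = u ` F' \<union> (\<Union>N\<in>\<B>. \<Union>m. V N m)"
    have "countable \<V>" using F'(2) \<B>(1) V by (auto simp: \<V>_def)
    moreover have "\<V> \<subseteq> \<U>" using u F'(1) V by (force simp: \<V>_def)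
    moreover have "S \<subseteq> \<Union> \<V>"
    proof
      fix p assume p: "p \<in> S"
      show "p \<in> \<Union> \<V>"
      proof (cases p)
        case (Inr x)
        then show ?thesis using Inr_cover[OF p] unfolding \<V>_def by blast
      next
        case (Inl xw)
        then obtain x w where xw: "p = Inl (x, w)" by (cases xw) auto
        obtain U where U: "U \<in> \<U>" "p \<in> U" using cover p by blast
        obtain N m where N: "N \<in> \<B>" "w \<in> N"
            "filippov_cone E x (sphere 0 1 \<inter> N) (1 / Suc m) \<subseteq> U"
          using openin_filippov_Inl[OF sub _ _ \<B>(2)] op U xw by metis
        then have "p \<in> P N m" using U p xw unfolding P_def by blast
        then show ?thesis using V[OF N(1), of m] N(1) unfolding \<V>_def by blast
      qed
    qed
    ultimately show "\<exists>\<V>. countable \<V> \<and> \<V> \<subseteq> \<U> \<and> S \<subseteq> \<Union> \<V>" by blast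
  qed
qed

section \<open>From weakly Luzin to hereditarily separable\<close>

lemma weakly_Luzin_imp_hereditarily_separable:
  assumes sub: "E \<subseteq> box 0 1" and E: "weakly_Luzin E"
  shows "hereditarily_separable (filippov_space E)"
  unfolding hereditarily_separable_def
proof (intro allI impI)
  fix S assume S: "S \<subseteq> topspace (filippov_space E)"
  then have carrier: "S \<subseteq> filippov_carrier E" using topspace_filippov_space[OF sub] by simp
  obtain \<B> :: "(real ^ 'a) set set" where \<B>: "countable \<B>" "topological_basis \<B>"
    using ex_countable_basis by blast
  \<comment> \<open>\<open>D0\<close> is dense in \<open>S\<close> only after projection. This
    suffices for Filippov balls and for cones whose Euclidean part meets the projection of
    \<open>S\<close>, but it may miss points that only a fibre part sees.\<close>
  obtain D0 where D0: "countable D0" "D0 \<subseteq> S" "filippov_proj ` S \<subseteq> closure (filippov_proj ` D0)"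
  proof -
    obtain Q where "countable Q" "Q \<subseteq> filippov_proj ` S" "filippov_proj ` S \<subseteq> closure Q"
      by (rule separable)
    then show ?thesis using that countable_subset_image[of Q filippov_proj S] by metis
  qed
  have dense: "\<exists>q\<in>D0. filippov_proj q \<in> G" if "open G" "p \<in> S" "filippov_proj p \<in> G" for G p
    using that D0(3) open_Int_closure_eq_empty[OF that(1), of "filippov_proj ` D0"] by blast
  \<comment> \<open>The base points at which \<open>D0\<close> fails for the shape
    \<open>(N, m)\<close>: \<open>S\<close> has a fibre point with direction in \<open>N\<close>,
    yet no point of \<open>D0\<close> projects into the cone.\<close>
  define T where "T N m = {x. (\<exists>w\<in>N. Inl (x, w) \<in> S) \<and>
      (\<forall>q\<in>D0. filippov_proj q \<notin> direction_cone x N (1 / Suc m))}" for N and m :: nat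
  have T: "countable (T N m)" if "N \<in> \<B>" for N m
  proof (cases "T N m = {}")
    case False
    then obtain w where w: "w \<in> N" "w \<in> sphere 0 1"
      using carrier by (force simp: T_def filippov_carrier_def)
    have "open N" using that \<B>(2) by (simp add: topological_basis_open)
    show ?thesis
    proof (rule weakly_Luzin_countable[OF E _ \<open>open N\<close> w, of _ "1 / Suc m"])
      show "T N m \<subseteq> E" using carrier by (auto simp: T_def filippov_carrier_def)
      \<comment> \<open>If \<open>y\<close> were in the cone at \<open>x\<close>, then, since
        \<open>S\<close> has a point over \<open>y\<close> and the cone is open, some point of
        \<open>D0\<close> would project into it, contradicting the choice of
        \<open>x\<close>.\<close>
      fix x y assume "x \<in> T N m" "y \<in> T N m"
      then show "y \<notin> direction_cone x N (1 / Suc m)"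
        using dense[OF open_direction_cone[OF \<open>open N\<close>]] unfolding T_def by fastforce
    qed simp
  qed simp
  \<comment> \<open>One witness from \<open>S\<close> for each exceptional base point repairs
    \<open>D0\<close>. The choice is meaningful for \<open>x\<close> in \<open>T N m\<close>, where
    a suitable \<open>w\<close> exists.\<close>
  define s where "s N x = (Inl (x, SOME w. w \<in> N \<and> Inl (x, w) \<in> S) :: 'a filippov_point)" for N x
  define D where "D = D0 \<union> (\<Union>N\<in>\<B>. \<Union>m. s N ` T N m)"
  have s: "\<exists>w\<in>N. s N x = Inl (x, w) \<and> Inl (x, w) \<in> S" if x: "x \<in> T N m" for N x m
  proof -
    have "\<exists>w. w \<in> N \<and> Inl (x, w) \<in> S" using x by (auto simp: T_def)
    from someI_ex[OF this] show ?thesis by (auto simp: s_def)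
  qed
  have "countable D" using D0(1) \<B>(1) T by (auto simp: D_def)
  moreover have DS: "D \<subseteq> S" using D0(2) s unfolding D_def by fastforce
  moreover have "S \<subseteq> filippov_space E closure_of D"
  proof
    fix p assume p: "p \<in> S"
    have "\<exists>q\<in>D. q \<in> U" if U: "p \<in> U" "openin (filippov_space E) U" for U
    proof (cases p)
      case (Inr x)
      then obtain e where e: "e > 0" "filippov_ball E x e \<subseteq> U"
        using openin_filippov_Inr[OF sub U(2)] U(1) by metis
      then obtain q where q: "q \<in> D0" "filippov_proj q \<in> ball x e"
        using dense[OF open_ball p, of x e] Inr by auto
      then have "q \<in> filippov_ball E x e"
        using D0(2) carrier by (auto simp: filippov_ball_def dist_norm norm_minus_commute)
      then show ?thesis using e q by (auto simp: D_def)
    next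
      case (Inl xw)
      then obtain x w where xw: "p = Inl (x, w)" by (cases xw) auto
      obtain N m where N: "N \<in> \<B>" "w \<in> N"
          "filippov_cone E x (sphere 0 1 \<inter> N) (1 / Suc m) \<subseteq> U"
        using openin_filippov_Inl[OF sub U(2) _ \<B>(2)] U(1) xw by metis
      show ?thesis
      \<comment> \<open>At an exceptional \<open>x\<close> the added witness lies in the fibre part
        of the cone; at any other \<open>x\<close> a point of \<open>D0\<close> projects into its
        Euclidean part.\<close>
      proof (cases "x \<in> T N m")
        case True
        then obtain z where z: "z \<in> N" "s N x = Inl (x, z)" "Inl (x, z) \<in> S" using s by blast
        then have "s N x \<in> filippov_cone E x (sphere 0 1 \<inter> N) (1 / Suc m)"
          using carrier by (auto simp: filippov_cone_eq filippov_carrier_def)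
        moreover have "s N x \<in> D" using True N(1) by (auto simp: D_def)
        ultimately show ?thesis using N(3) by blast
      next
        case False
        then obtain q where q: "q \<in> D0" "filippov_proj q \<in> direction_cone x N (1 / Suc m)"
          using p xw N(2) by (auto simp: T_def)
        then have "q \<in> filippov_cone E x (sphere 0 1 \<inter> N) (1 / Suc m)"
          using D0(2) carrier by (auto simp: filippov_cone_eq)
        then show ?thesis using N(3) q by (auto simp: D_def)
      qed
    qed
    then show "p \<in> filippov_space E closure_of D"
      using p S by (auto simp: in_closure_of)
  qed
  ultimately show "separable_space (subtopology (filippov_space E) S)"
    using S unfolding separable_space_def
    by (intro exI[of _ D]) (auto simp: closure_of_subtopology Int_absorb1 Int_absorb2)
qed

section \<open>Discrete subsets and the return to weakly Luzin\<close>

lemma hereditarily_separable_imp_countable_discrete: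
  assumes "hereditarily_separable X" "discrete_subset X D"
  shows "countable D"
proof -
  have "separable_space (subtopology X D)" "subtopology X D = discrete_topology D"
    using assms unfolding hereditarily_separable_def discrete_subset_def by blast+
  then show ?thesis by (simp add: separable_space_discrete_topology)
qed

lemma hereditarily_Lindelof_imp_countable_discrete:
  assumes "hereditarily_Lindelof X" "discrete_subset X D"
  shows "countable D"
proof -
  have "Lindelof_space (subtopology X D)" "subtopology X D = discrete_topology D"
    using assms unfolding hereditarily_Lindelof_def discrete_subset_def by blast+
  then have "Lindelof_space (discrete_topology D)" by simp
  \<comment> \<open>No proper subfamily of the singletons covers \<open>D\<close>, so a countable
    subcover forces \<open>D\<close> to be countable.\<close>
  moreover have "\<forall>U\<in>(\<lambda>x. {x}) ` D. openin (discrete_topology D) U" by auto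
  ultimately obtain \<V> where \<V>: "countable \<V>" "\<V> \<subseteq> (\<lambda>x. {x}) ` D" "D \<subseteq> \<Union> \<V>"
    unfolding Lindelof_space_alt by (auto dest!: spec[of _ "(\<lambda>x. {x}) ` D"])
  then have "countable (\<Union>V\<in>\<V>. V)" by (intro countable_UN) auto
  then show ?thesis using \<V>(3) by (auto intro: countable_subset)
qed

text \<open>Skinniness leaves a unit vector \<open>w\<close> outside the closed set
  \<open>?K\<close> of directions. The cone at \<open>x\<close> with directions in
  \<open>- ?K\<close> contains \<open>(x, w)\<close>, but no other point of the section: for
  \<open>y\<close> in \<open>T\<close> distinct from \<open>x\<close>, the direction of
  \<open>y - x\<close> lies in \<open>?K\<close> at whatever distance, so radius 1 will do.\<close>

lemma skinny_imp_discrete_section: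
  assumes sub: "E \<subseteq> box 0 1" and T: "T \<subseteq> E" "skinny T"
  obtains w where "discrete_subset (filippov_space E) ((\<lambda>x. Inl (x, w)) ` T)"
proof -
  let ?K = "closure (rho ` diff_star T)"
  have "rho ` diff_star T \<subseteq> sphere 0 1"
  proof
    fix v assume "v \<in> rho ` diff_star T"
    then obtain x y where "v = rho (x - y)" "x \<noteq> y" by (auto simp: diff_star_def)
    then show "v \<in> sphere 0 1" using rho_sphere[of "x - y"] by simp
  qed
  then have "?K \<subseteq> sphere 0 1" by (intro closure_minimal) auto
  then obtain w where w: "w \<in> sphere 0 1" "w \<notin> ?K" using T(2) unfolding skinny_def by blast
  let ?D = "(\<lambda>x. Inl (x, w)) ` T"
  have D: "?D \<subseteq> topspace (filippov_space E)"
    using T(1) w(1) by (auto simp: topspace_filippov_space[OF sub] filippov_carrier_def)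
  have "openin (subtopology (filippov_space E) ?D) {Inl (x, w)}" if x: "x \<in> T" for x
  proof -
    let ?W = "sphere 0 1 \<inter> - ?K" and ?B = "filippov_cone E x (sphere 0 1 \<inter> - ?K) 1"
    have "openin (top_of_set (sphere 0 1)) ?W" by (intro openin_open_Int) auto
    then have "?B \<in> filippov_base E" using x T(1) zero_less_one unfolding filippov_base_def by blast
    then have "openin (filippov_space E) ?B"
      unfolding filippov_space_def by (rule topology_generated_by_Basis)
    moreover have "?B \<inter> ?D = {Inl (x, w)}"
    proof -
      have "rho (y - x) \<in> ?K" if "y \<in> T" "y \<noteq> x" for y
        using that x closure_subset[of "rho ` diff_star T"] by (auto simp: diff_star_def)
      then have "y = x" if "y \<in> T" "y \<in> direction_cone x (- ?K) 1" for y
        using that by (auto simp: direction_cone_def)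
      then show ?thesis using x w by (auto simp: filippov_cone_eq)
    qed
    ultimately show ?thesis by (metis openin_subtopology)
  qed
  then have "subtopology (filippov_space E) ?D = discrete_topology ?D"
    using D unfolding eq_commute[of _ "discrete_topology _"] discrete_topology_unique
    by (auto simp: Int_absorb1)
  then show ?thesis using that D unfolding discrete_subset_def by blast
qed

theorem theorem2p5:
  fixes E :: "(real ^ 'n) set"
  assumes "E \<subseteq> box 0 1"
    and "uncountable E"
  shows "(weakly_Luzin E \<longleftrightarrow> hereditarily_separable (filippov_space E)) \<and>
    (weakly_Luzin E \<longleftrightarrow> hereditarily_Lindelof (filippov_space E)) \<and>
    (weakly_Luzin E \<longleftrightarrow> (\<nexists>D. discrete_subset (filippov_space E) D \<and> uncountable D))"
proof -
  \<comment> \<open>The absence of uncountable discrete subsets closes the cycle: it follows from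
    either hereditary property, and here it gives back the weak Luzin property, because a section
    has as many points as its base.\<close>
  have "weakly_Luzin E" if "\<nexists>D. discrete_subset (filippov_space E) D \<and> uncountable D"
    unfolding weakly_Luzin_def
  proof (intro conjI allI impI)
    fix T assume "T \<subseteq> E \<and> skinny T"
    then obtain w where "discrete_subset (filippov_space E) ((\<lambda>x. Inl (x, w)) ` T)"
      using skinny_imp_discrete_section[OF assms(1)] by blast
    then have "countable ((\<lambda>x. Inl (x, w) :: 'n filippov_point) ` T)" using that by blast
    then show "countable T" by (rule countable_image_inj_on) (simp add: inj_on_def)
  qed (rule assms(2))
  then show ?thesis
    using weakly_Luzin_imp_hereditarily_separable[OF assms(1)]
      weakly_Luzin_imp_hereditarily_Lindelof[OF assms(1)]
      hereditarily_separable_imp_countable_discrete[of "filippov_space E"]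
      hereditarily_Lindelof_imp_countable_discrete[of "filippov_space E"]
    by metis
qed

end
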